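(* Let $a<b$ be real numbers and let $X_{1,1},X_{1,2},X_{2,1},X_{2,2}$ be independent random variables, each uniformly distributed on $[a,b]$. Let $\tilde X$ be the first addend of the larger of the two sums $X_{1,1}+X_{1,2}$ and $X_{2,1}+X_{2,2}$. Then $\tilde X$ has density $$f_{\tilde X}(x)=\frac{-2}{3(a-b)^4}x^3+\frac{a+b}{(a-b)^4}x^2+\frac{a^2-4ab+b^2}{(a-b)^4}x+\frac{-5a^3+12a^2b-6ab^2+b^3}{3(a-b)^4},\qquad a\le x\le b,$$ and $f_{\tilde X}(x)=0$ outside $[a,b]$.
   Context: The first addend of the larger sum is $\tilde X:=X_{J,1}$, where $J\in\{1,2\}$ is the almost surely unique index maximizing $X_{j,1}+X_{j,2}$. *)

theory Defs
  imports "HOL-Probability.Probability"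
begin

definition first_addend_density :: "real \<Rightarrow> real \<Rightarrow> real \<Rightarrow> real" where
  "first_addend_density a b x =
     (if a \<le> x \<and> x \<le> b
      then (-2) / (3 * (a - b)^4) * x^3
         + (a + b) / (a - b)^4 * x^2
         + (a^2 - 4*a*b + b^2) / (a - b)^4 * x
         + (-5 * a^3 + 12 * a^2 * b - 6 * a * b^2 + b^3) / (3 * (a - b)^4)
      else 0)"

end

theory Submission
  imports Defs
begin

text \<open>
  With \<open>L = b - a\<close>, ties between the two sums are null events, so by symmetry the density at
  \<open>x \<in> [a, b]\<close> is \<open>2 / L\<close> times the probability that \<open>U + V < x + Y\<close> for independent uniform
  \<open>Y\<close>, \<open>U\<close>, \<open>V\<close>. Expressed through truncated powers, where each is the derivative of the next,
  the three integrations become successive finite differences and need no case distinction on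
  the shape of the triangular distribution.
\<close>

section \<open>Truncated powers and their derivatives\<close>

text \<open>Dividing by \<open>fact n\<close> keeps constant factors out of differentiation. Since
  \<open>0 ^ 0 = 1\<close>, degree 0 is the constant 1 and not a step function; the proof works with
  degrees 1 to 3.\<close>

definition truncated_power :: "nat \<Rightarrow> real \<Rightarrow> real" where
  "truncated_power n t = max 0 t ^ n / fact n"

lemma truncated_power_nonneg: "0 \<le> truncated_power n t"
  by (simp add: truncated_power_def)

text \<open>Away from 0 the function agrees locally with 0 or with a monomial; only the point 0
  needs an estimate. The rule starts at degree 2 because the truncated power of degree 1 has a
  corner at 0.\<close>

lemma DERIV_truncated_power:
  "(truncated_power (Suc (Suc n)) has_real_derivative truncated_power (Suc n) t) (at t)"
proof -
  consider "t < 0" | "t = 0" | "t > 0" by linarith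
  then show ?thesis
  proof cases
    case 1
    have "((\<lambda>_. 0) has_real_derivative truncated_power (Suc n) t) (at t)"
      using 1 by (simp add: truncated_power_def)
    then show ?thesis
      by (rule has_field_derivative_transform_within_open[where S = "{..<0}"])
        (use 1 in \<open>auto simp: truncated_power_def\<close>)
  next
    case 2
    \<comment> \<open>The function vanishes at 0, so this is its difference quotient there. The
      truncated power one degree lower dominates it and tends to 0.\<close>
    have "((\<lambda>y. truncated_power (Suc (Suc n)) y / y) \<longlongrightarrow> 0) (at 0)"
    proof (rule Lim_null_comparison)
      show "\<forall>\<^sub>F y in at 0. norm (truncated_power (Suc (Suc n)) y / y) \<le> truncated_power (Suc n) y"
      proof (rule always_eventually, rule allI)
        fix y :: real
        show "norm (truncated_power (Suc (Suc n)) y / y) \<le> truncated_power (Suc n) y"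
        proof (cases "y > 0")
          case True
          then have "truncated_power (Suc (Suc n)) y / y = truncated_power (Suc n) y / real (Suc (Suc n))"
            by (simp add: truncated_power_def)
          also have "\<dots> \<le> truncated_power (Suc n) y / 1"
            by (intro divide_left_mono truncated_power_nonneg) auto
          finally show ?thesis
            using True truncated_power_nonneg[of "Suc (Suc n)" y] by simp
        qed (simp add: truncated_power_def max_def)
      qed
      have "isCont (truncated_power (Suc n)) 0"
        unfolding truncated_power_def[abs_def] by (intro continuous_intros) simp_all
      then show "((\<lambda>y. truncated_power (Suc n) y) \<longlongrightarrow> 0) (at 0)"
        by (simp add: isCont_def truncated_power_def[of "Suc n" 0])
    qed
    then show ?thesis
      using 2 by (simp add: has_field_derivative_iff truncated_power_def)
  next
    case 3
    have "((\<lambda>t. t ^ Suc (Suc n) / fact (Suc (Suc n))) has_real_derivative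
        real (Suc (Suc n)) * t ^ Suc n / fact (Suc (Suc n))) (at t)"
      using DERIV_cdivide[OF DERIV_pow[of "Suc (Suc n)" t]] by (simp only: diff_Suc_Suc diff_zero)
    also have "real (Suc (Suc n)) * t ^ Suc n / fact (Suc (Suc n)) = t ^ Suc n / fact (Suc n)"
      by (simp only: fact_Suc[of "Suc n"] of_nat_mult) (simp add: divide_simps del: fact_Suc of_nat_Suc power_Suc)
    also have "\<dots> = truncated_power (Suc n) t"
      using 3 by (simp add: truncated_power_def)
    finally show ?thesis
      by (rule has_field_derivative_transform_within_open[where S = "{0<..}"])
        (use 3 in \<open>auto simp: truncated_power_def\<close>)
  qed
qed

section \<open>Integrals against the uniform law\<close>

text \<open>This turns each averaging over a uniform variable into a finite difference of an
  antiderivative. Nonnegativity matters because \<open>ennreal\<close> cuts negative values off at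
  0.\<close>

lemma nn_integral_uniform_FTC:
  fixes F f :: "real \<Rightarrow> real"
  assumes "a < b"
    and "f \<in> borel_measurable borel"
    and "\<And>x. a \<le> x \<Longrightarrow> x \<le> b \<Longrightarrow> (F has_real_derivative f x) (at x)"
    and "\<And>x. 0 \<le> f x"
  shows "(\<integral>\<^sup>+x. ennreal (f x) \<partial>uniform_measure lborel {a..b}) = ennreal ((F b - F a) / (b - a))"
proof -
  have FTC: "(\<integral>\<^sup>+x. ennreal (f x) * indicator {a..b} x \<partial>lborel) = ennreal (F b - F a)"
    using assms by (intro nn_integral_FTC_Icc) auto
  \<comment> \<open>A nonnegative increment lets the division by \<open>b - a\<close> move inside
    \<open>ennreal\<close>.\<close>
  have "F a \<le> F b"
    using assms by (intro DERIV_nonneg_imp_nondecreasing[of a b F]) auto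
  with FTC assms show ?thesis
    by (subst nn_integral_uniform_measure) (auto simp: divide_ennreal)
qed

text \<open>The uniform distribution function is a ramp that starts at \<open>a\<close> and becomes
  flat at \<open>b\<close>. Writing it as a difference of two ramps covers every real
  \<open>t\<close> with one formula, ready for further integration.\<close>

lemma nn_integral_uniform_less:
  fixes a b t :: real
  assumes "a < b"
  shows "(\<integral>\<^sup>+v. indicator {..<t} v \<partial>uniform_measure lborel {a..b}) =
    ennreal ((truncated_power 1 (t - a) - truncated_power 1 (t - b)) / (b - a))"
proof -
  have "emeasure lborel ({a..b} \<inter> {..<t}) =
    ennreal (truncated_power 1 (t - a) - truncated_power 1 (t - b))"
  proof -
    consider "t \<le> a" | "a < t" "t \<le> b" | "b < t" by linarith
    then show ?thesis
    proof cases
      case 1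
      then have "{a..b} \<inter> {..<t} = {}" by auto
      with 1 assms show ?thesis by (simp add: truncated_power_def)
    next
      case 2
      then have "{a..b} \<inter> {..<t} = {a..<t}" by auto
      with 2 show ?thesis by (simp add: truncated_power_def)
    next
      case 3
      then have "{a..b} \<inter> {..<t} = {a..b}" by auto
      with 3 assms show ?thesis by (simp add: truncated_power_def)
    qed
  qed
  moreover have "truncated_power 1 (t - a) - truncated_power 1 (t - b) \<ge> 0"
    using assms by (simp add: truncated_power_def)
  ultimately show ?thesis
    using assms by (simp add: divide_ennreal)
qed

text \<open>For fixed \<open>u\<close> the event is \<open>v < s - u\<close>, so the inner integral
  is a difference of ramps. Averaging over \<open>u\<close> raises the degree and takes one more
  difference with step \<open>b - a\<close>. The result is the distribution function of the
  triangular law.\<close>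

lemma nn_integral_uniform_sum_less:
  fixes a b s :: real
  assumes "a < b"
  shows "(\<integral>\<^sup>+u. \<integral>\<^sup>+v. indicator {(u, v). u + v < s} (u, v)
      \<partial>uniform_measure lborel {a..b} \<partial>uniform_measure lborel {a..b}) =
    ennreal ((truncated_power 2 (s - 2 * a) - 2 * truncated_power 2 (s - a - b)
      + truncated_power 2 (s - 2 * b)) / (b - a)^2)"
proof -
  have "(\<integral>\<^sup>+u. \<integral>\<^sup>+v. indicator {(u, v). u + v < s} (u, v)
      \<partial>uniform_measure lborel {a..b} \<partial>uniform_measure lborel {a..b}) =
    (\<integral>\<^sup>+u. ennreal ((truncated_power 1 (s - u - a) - truncated_power 1 (s - u - b)) / (b - a))
      \<partial>uniform_measure lborel {a..b})"
  proof (rule nn_integral_cong)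
    fix u
    have "(\<lambda>v. indicator {(u, v). u + v < s} (u, v)) = (indicator {..<s - u} :: real \<Rightarrow> ennreal)"
      by (auto simp: fun_eq_iff indicator_def)
    then show "(\<integral>\<^sup>+v. indicator {(u, v). u + v < s} (u, v) \<partial>uniform_measure lborel {a..b}) =
      ennreal ((truncated_power 1 (s - u - a) - truncated_power 1 (s - u - b)) / (b - a))"
      using nn_integral_uniform_less[OF assms, of "s - u"] by simp
  qed
  \<comment> \<open>The variable \<open>u\<close> enters through \<open>s - u\<close>, hence the
    minus sign in the antiderivative. The two mixed endpoint terms coincide, which produces the
    coefficient 2.\<close>
  also have "\<dots> = ennreal
    ((- (truncated_power 2 (s - b - a) - truncated_power 2 (s - b - b)) / (b - a)
      - (- (truncated_power 2 (s - a - a) - truncated_power 2 (s - a - b)) / (b - a))) / (b - a))"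
  proof (rule nn_integral_uniform_FTC[OF assms])
    show "(\<lambda>u. (truncated_power 1 (s - u - a) - truncated_power 1 (s - u - b)) / (b - a))
        \<in> borel_measurable borel"
      unfolding truncated_power_def by measurable
    show "((\<lambda>u. - (truncated_power 2 (s - u - a) - truncated_power 2 (s - u - b)) / (b - a))
        has_real_derivative (truncated_power 1 (s - u - a) - truncated_power 1 (s - u - b)) / (b - a)) (at u)" for u
      by (rule DERIV_cdivide derivative_eq_intros
          DERIV_chain2[OF DERIV_truncated_power[of 0, folded numeral_2_eq_2 One_nat_def]] refl | simp)+
    show "0 \<le> (truncated_power 1 (s - u - a) - truncated_power 1 (s - u - b)) / (b - a)" for u
      using assms by (simp add: truncated_power_def)
  qed
  finally show ?thesis
    by (simp add: power2_eq_square diff_divide_distrib add_divide_distrib algebra_simps)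
qed

text \<open>One more averaging, now over \<open>y\<close>, gives a difference of truncated cubes.
  For \<open>x\<close> between \<open>a\<close> and \<open>b\<close> the sign of each argument is
  known, so the truncations disappear.\<close>

lemma nn_integral_uniform_sum_less_sum:
  fixes a b x :: real
  assumes "a < b" "a \<le> x" "x \<le> b"
  shows "(\<integral>\<^sup>+y. \<integral>\<^sup>+u. \<integral>\<^sup>+v. indicator {(u, v). u + v < x + y} (u, v)
      \<partial>uniform_measure lborel {a..b} \<partial>uniform_measure lborel {a..b} \<partial>uniform_measure lborel {a..b}) =
    ennreal (((x + b - 2 * a)^3 - 3 * (x - a)^3) / (6 * (b - a)^3))"
proof -
  let ?F = "\<lambda>y. (truncated_power 3 (x + y - 2 * a) - 2 * truncated_power 3 (x + y - a - b)
      + truncated_power 3 (x + y - 2 * b)) / (b - a)^2"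
  have "(\<integral>\<^sup>+y. \<integral>\<^sup>+u. \<integral>\<^sup>+v. indicator {(u, v). u + v < x + y} (u, v)
      \<partial>uniform_measure lborel {a..b} \<partial>uniform_measure lborel {a..b} \<partial>uniform_measure lborel {a..b}) =
    ennreal ((?F b - ?F a) / (b - a))"
    unfolding nn_integral_uniform_sum_less[OF assms(1)]
  proof (rule nn_integral_uniform_FTC[OF assms(1)])
    show "(\<lambda>y. (truncated_power 2 (x + y - 2 * a) - 2 * truncated_power 2 (x + y - a - b)
        + truncated_power 2 (x + y - 2 * b)) / (b - a)^2) \<in> borel_measurable borel"
      unfolding truncated_power_def by measurable
    show "(?F has_real_derivative (truncated_power 2 (x + y - 2 * a) - 2 * truncated_power 2 (x + y - a - b)
        + truncated_power 2 (x + y - 2 * b)) / (b - a)^2) (at y)" for y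
      by (rule DERIV_cdivide derivative_eq_intros
          DERIV_chain2[OF DERIV_truncated_power[of 1, simplified, folded numeral_2_eq_2 numeral_3_eq_3]] refl | simp)+
    \<comment> \<open>Second differences of the convex function \<open>truncated_power 2\<close> are
      nonnegative; the integrand is such a difference, centred at \<open>x + y - a - b\<close> with
      step \<open>b - a\<close>.\<close>
    have second_difference_nonneg: "0 \<le> truncated_power 2 (s + d) - 2 * truncated_power 2 s + truncated_power 2 (s - d)"
      if "0 \<le> d" for s d
    proof -
      consider "s + d \<le> 0" | "s \<le> 0" "0 < s + d" | "0 < s" "s - d \<le> 0" | "0 < s - d" by linarith
      then show ?thesis
      proof cases
        case 3
        \<comment> \<open>In this case \<open>s \<le> d\<close>, so \<open>s + d\<close> is at least
          \<open>2 * s\<close>.\<close>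
        then have "(2 * s)^2 \<le> (s + d)^2"
          by (intro power_mono) auto
        moreover have "2 * s^2 \<le> (2 * s)^2"
          by simp
        ultimately have "2 * s^2 \<le> (s + d)^2"
          by linarith
        with 3 that show ?thesis by (simp add: truncated_power_def fact_numeral max_def)
      next
        case 4
        with that show ?thesis by (simp add: truncated_power_def max_def field_simps power2_eq_square)
      qed (use that in \<open>auto simp: truncated_power_def max_def\<close>)
    qed
    show "0 \<le> (truncated_power 2 (x + y - 2 * a) - 2 * truncated_power 2 (x + y - a - b)
        + truncated_power 2 (x + y - 2 * b)) / (b - a)^2" for y
      using second_difference_nonneg[of "b - a" "x + y - a - b"] assms by (simp add: algebra_simps)
  qed
  also have "(?F b - ?F a) / (b - a) = ((x + b - 2 * a)^3 - 3 * (x - a)^3) / (6 * (b - a)^3)"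
  proof -
    \<comment> \<open>The last three arguments are at most 0 because \<open>x \<le> b\<close>. The
      value at \<open>x - a\<close> occurs twice in \<open>?F b\<close> and once in
      \<open>?F a\<close>, whence the coefficient 3.\<close>
    have "truncated_power 3 (x + b - 2 * a) = (x + b - 2 * a)^3 / 6"
      "truncated_power 3 (x + b - a - b) = (x - a)^3 / 6"
      "truncated_power 3 (x + a - 2 * a) = (x - a)^3 / 6"
      "truncated_power 3 (x + b - 2 * b) = 0"
      "truncated_power 3 (x + a - a - b) = 0"
      "truncated_power 3 (x + a - 2 * b) = 0"
      using assms by (auto simp: truncated_power_def fact_numeral max_def)
    moreover have "((p / 6 - 2 * (q / 6) + 0) / L^2 - (q / 6 - 2 * 0 + 0) / L^2) / L =
        (p - 3 * q) / (6 * L^3)" for p q L :: real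
      by (cases "L = 0") (simp_all add: field_simps power2_eq_square power3_eq_cube)
    ultimately show ?thesis
      by (simp only:)
  qed
  finally show ?thesis .
qed

section \<open>Closed form and sign of the density\<close>

text \<open>Since \<open>x + b - 2 * a\<close> is the sum of \<open>x - a\<close> and
  \<open>b - a\<close>, it is at least \<open>2 * (x - a)\<close>, and the cube of 2 exceeds 3. This
  makes the numerator of the density nonnegative.\<close>

lemma cube_sum_ge:
  fixes a b x :: real
  assumes "a \<le> x" "x \<le> b"
  shows "3 * (x - a)^3 \<le> (x + b - 2 * a)^3"
proof -
  have "(2 * (x - a))^3 \<le> (x + b - 2 * a)^3"
    using assms by (intro power_mono) auto
  moreover have "3 * (x - a)^3 \<le> (2 * (x - a))^3"
    unfolding power_mult_distrib using assms by simp
  ultimately show ?thesis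
    by linarith
qed

text \<open>Links the expanded cubic of the definition to the difference of cubes that the
  integration yields; the exponent 4 is even, so \<open>a - b\<close> may be replaced by
  \<open>b - a\<close>.\<close>

lemma first_addend_density_eq:
  assumes "a \<le> x" "x \<le> b"
  shows "first_addend_density a b x = ((x + b - 2 * a)^3 - 3 * (x - a)^3) / (3 * (b - a)^4)"
proof -
  have "(a - b)^4 = (b - a)^4" by (simp add: power4_eq_xxxx algebra_simps)
  moreover have "(x + b - 2 * a)^3 - 3 * (x - a)^3 =
      -2 * x^3 + 3 * (a + b) * x^2 + 3 * (a^2 - 4*a*b + b^2) * x
      + (-5 * a^3 + 12 * a^2 * b - 6 * a * b^2 + b^3)"
    by (simp add: algebra_simps power3_eq_cube power2_eq_square)
  moreover have "-2 / (3 * D) * x^3 + p / D * x^2 + q / D * x + r / (3 * D) =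
      (-2 * x^3 + 3 * p * x^2 + 3 * q * x + r) / (3 * D)" for p q r D :: real
    by (cases "D = 0") (simp_all add: field_simps)
  ultimately show ?thesis
    using assms unfolding first_addend_density_def by (simp only: simp_thms if_True mult.assoc)
qed

lemma first_addend_density_nonneg: "0 \<le> first_addend_density a b x"
proof (cases "a \<le> x \<and> x \<le> b")
  case True
  then show ?thesis by (simp add: first_addend_density_eq cube_sum_ge)
qed (auto simp: first_addend_density_def)

section \<open>Four independent variables with a common law\<close>

text \<open>Independence makes the joint law a product measure, and Tonelli's theorem turns its
  integral into an iterated one. Free indices allow either pair to be integrated first.\<close>

lemma (in prob_space) nn_integral_iid4:
  fixes Y :: "'i \<Rightarrow> 'a \<Rightarrow> real"
  assumes indep: "indep_vars (\<lambda>_. borel) Y {i, j, k, l}"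
    and dist: "distinct [i, j, k, l]"
    and law: "\<And>m. m \<in> {i, j, k, l} \<Longrightarrow> distr M borel (Y m) = N"
    and f[measurable]: "f \<in> borel_measurable (borel \<Otimes>\<^sub>M borel \<Otimes>\<^sub>M borel \<Otimes>\<^sub>M borel)"
  shows "(\<integral>\<^sup>+\<omega>. f (Y i \<omega>, Y j \<omega>, Y k \<omega>, Y l \<omega>) \<partial>M) =
    (\<integral>\<^sup>+x. \<integral>\<^sup>+y. \<integral>\<^sup>+u. \<integral>\<^sup>+v. f (x, y, u, v) \<partial>N \<partial>N \<partial>N \<partial>N)"
proof -
  let ?I = "{i, j, k, l}"
  have Y[measurable]: "Y m \<in> borel_measurable M" if "m \<in> ?I" for m
    using indep that by (auto simp: indep_vars_def)
  have sets_N[measurable_cong]: "sets N = sets borel"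
    using law[of i, symmetric] by simp
  have "prob_space N"
    using law[of i, symmetric] prob_space_distr[OF Y[of i]] by simp
  then interpret N: product_sigma_finite "\<lambda>_. N"
    by (simp add: product_sigma_finite_def prob_space_imp_sigma_finite)
  have "distr M (\<Pi>\<^sub>M m\<in>?I. borel) (\<lambda>\<omega>. \<lambda>m\<in>?I. Y m \<omega>) = (\<Pi>\<^sub>M m\<in>?I. distr M borel (Y m))"
    by (rule indep_vars_iff_distr_eq_PiM'[THEN iffD1, OF _ _ indep]) (use Y in auto)
  also have "\<dots> = (\<Pi>\<^sub>M m\<in>?I. N)"
    by (intro PiM_cong law) auto
  finally have joint: "distr M (\<Pi>\<^sub>M m\<in>?I. borel) (\<lambda>\<omega>. \<lambda>m\<in>?I. Y m \<omega>) = (\<Pi>\<^sub>M m\<in>?I. N)" .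
  have "(\<integral>\<^sup>+\<omega>. f (Y i \<omega>, Y j \<omega>, Y k \<omega>, Y l \<omega>) \<partial>M) =
    (\<integral>\<^sup>+z. f (z i, z j, z k, z l) \<partial>distr M (\<Pi>\<^sub>M m\<in>?I. borel) (\<lambda>\<omega>. \<lambda>m\<in>?I. Y m \<omega>))"
    by (subst nn_integral_distr) (auto intro!: measurable_restrict Y)
  also have "\<dots> = (\<integral>\<^sup>+z. f (z i, z j, z k, z l) \<partial>(\<Pi>\<^sub>M m\<in>?I. N))"
    unfolding joint ..
  \<comment> \<open>The coordinates are split off one at a time, each new integral going outside
    those that remain; distinctness of the indices keeps the coordinates separate.\<close>
  also have "\<dots> = (\<integral>\<^sup>+x. \<integral>\<^sup>+z. f (x, z j, z k, z l) \<partial>(\<Pi>\<^sub>M m\<in>{j, k, l}. N) \<partial>N)"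
    using dist by (subst N.product_nn_integral_insert_rev) auto
  also have "\<dots> = (\<integral>\<^sup>+x. \<integral>\<^sup>+y. \<integral>\<^sup>+z. f (x, y, z k, z l) \<partial>(\<Pi>\<^sub>M m\<in>{k, l}. N) \<partial>N \<partial>N)"
    using dist by (subst N.product_nn_integral_insert_rev) auto
  also have "\<dots> = (\<integral>\<^sup>+x. \<integral>\<^sup>+y. \<integral>\<^sup>+u. \<integral>\<^sup>+z. f (x, y, u, z l) \<partial>(\<Pi>\<^sub>M m\<in>{l}. N) \<partial>N \<partial>N \<partial>N)"
    using dist by (subst N.product_nn_integral_insert_rev) auto
  also have "\<dots> = (\<integral>\<^sup>+x. \<integral>\<^sup>+y. \<integral>\<^sup>+u. \<integral>\<^sup>+v. f (x, y, u, v) \<partial>N \<partial>N \<partial>N \<partial>N)"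
    by (subst N.product_nn_integral_singleton) auto
  finally show ?thesis .
qed

text \<open>This is the contribution of the event that the pair \<open>i\<close>, \<open>j\<close>
  has the larger sum. Given the value \<open>x\<close> of \<open>Y i\<close>, the other three
  integrals give the probability of winning. The symmetric event supplies the other half of the
  density.\<close>

lemma (in prob_space) nn_integral_first_addend_of_larger_sum:
  fixes Y :: "'i \<Rightarrow> 'a \<Rightarrow> real"
  assumes "a < b"
    and indep: "indep_vars (\<lambda>_. borel) Y {i, j, k, l}"
    and dist: "distinct [i, j, k, l]"
    and law: "\<And>m. m \<in> {i, j, k, l} \<Longrightarrow> distr M borel (Y m) = uniform_measure lborel {a..b}"
    and A[measurable]: "A \<in> sets borel"
  shows "(\<integral>\<^sup>+\<omega>. indicator A (Y i \<omega>) * indicator {..<Y i \<omega> + Y j \<omega>} (Y k \<omega> + Y l \<omega>) \<partial>M) =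
    (\<integral>\<^sup>+x. ennreal (first_addend_density a b x / 2) * indicator A x \<partial>lborel)"
proof -
  let ?N = "uniform_measure lborel {a..b}"
  let ?f = "\<lambda>(x, y, u, v). indicator A x * indicator {(u, v). u + v < x + y} (u, v) :: ennreal"
  let ?H = "\<lambda>x. ennreal (((x + b - 2 * a)^3 - 3 * (x - a)^3) / (6 * (b - a)^3))"
  have f: "?f \<in> borel_measurable (borel \<Otimes>\<^sub>M borel \<Otimes>\<^sub>M borel \<Otimes>\<^sub>M borel)"
    by (simp add: indicator_def cong: if_cong) measurable
  have "(\<integral>\<^sup>+\<omega>. indicator A (Y i \<omega>) * indicator {..<Y i \<omega> + Y j \<omega>} (Y k \<omega> + Y l \<omega>) \<partial>M) =
    (\<integral>\<^sup>+\<omega>. ?f (Y i \<omega>, Y j \<omega>, Y k \<omega>, Y l \<omega>) \<partial>M)"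
    by (intro nn_integral_cong) (auto simp: indicator_def)
  also have "\<dots> = (\<integral>\<^sup>+x. \<integral>\<^sup>+y. \<integral>\<^sup>+u. \<integral>\<^sup>+v. ?f (x, y, u, v) \<partial>?N \<partial>?N \<partial>?N \<partial>?N)"
    by (rule nn_integral_iid4[OF indep dist law f])
  also have "\<dots> = (\<integral>\<^sup>+x. indicator A x *
      (\<integral>\<^sup>+y. \<integral>\<^sup>+u. \<integral>\<^sup>+v. indicator {(u, v). u + v < x + y} (u, v) \<partial>?N \<partial>?N \<partial>?N) \<partial>?N)"
    by (intro nn_integral_cong) (auto simp: indicator_def)
  \<comment> \<open>The closed form of the winning probability holds for \<open>x\<close> in
    \<open>{a..b}\<close>, which is almost everywhere for the uniform law.\<close>
  also have "\<dots> = (\<integral>\<^sup>+x. indicator A x * ?H x \<partial>?N)"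
    by (intro nn_integral_cong_AE AE_uniform_measureI)
      (auto simp: nn_integral_uniform_sum_less_sum[OF \<open>a < b\<close>])
  also have "\<dots> = (\<integral>\<^sup>+x. indicator A x * ?H x * indicator {a..b} x \<partial>lborel) / ennreal (b - a)"
    using \<open>a < b\<close> by (subst nn_integral_uniform_measure) auto
  also have "\<dots> = (\<integral>\<^sup>+x. indicator A x * ?H x * indicator {a..b} x / ennreal (b - a) \<partial>lborel)"
    by (subst nn_integral_divide) auto
  also have "\<dots> = (\<integral>\<^sup>+x. ennreal (first_addend_density a b x / 2) * indicator A x \<partial>lborel)"
  proof (intro nn_integral_cong)
    fix x
    show "indicator A x * ?H x * indicator {a..b} x / ennreal (b - a) =
      ennreal (first_addend_density a b x / 2) * indicator A x"
    proof (cases "a \<le> x \<and> x \<le> b")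
      case True
      let ?h = "((x + b - 2 * a)^3 - 3 * (x - a)^3) / (6 * (b - a)^3)"
      have "0 \<le> ?h"
        using True cube_sum_ge[of a x b] by (intro divide_nonneg_nonneg) auto
      then have "ennreal ?h / ennreal (b - a) = ennreal (?h / (b - a))"
        using \<open>a < b\<close> by (intro divide_ennreal) auto
      also have "?h / (b - a) = first_addend_density a b x / 2"
        using True by (simp add: first_addend_density_eq power4_eq_xxxx power3_eq_cube mult.assoc)
      finally show ?thesis
        using True by (auto simp: indicator_def)
    qed (auto simp: first_addend_density_def)
  qed
  finally show ?thesis .
qed

text \<open>Once three of the variables are fixed, a tie forces the fourth to take a single value,
  and a point is a null set. The indicator of a tie therefore has integral 0.\<close>

lemma (in prob_space) AE_sums_neq:
  fixes Y :: "'i \<Rightarrow> 'a \<Rightarrow> real"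
  assumes indep: "indep_vars (\<lambda>_. borel) Y {i, j, k, l}"
    and dist: "distinct [i, j, k, l]"
    and law: "\<And>m. m \<in> {i, j, k, l} \<Longrightarrow> distr M borel (Y m) = uniform_measure lborel {a..b}"
  shows "AE \<omega> in M. Y i \<omega> + Y j \<omega> \<noteq> Y k \<omega> + Y l \<omega>"
proof -
  let ?N = "uniform_measure lborel {a..b}"
  let ?f = "\<lambda>(x, y, u, v :: real). indicator {0} (x + y - u - v) :: ennreal"
  have Y[measurable]: "Y m \<in> borel_measurable M" if "m \<in> {i, j, k, l}" for m
    using indep that by (auto simp: indep_vars_def)
  have [measurable]: "Y i \<in> borel_measurable M" "Y j \<in> borel_measurable M"
    "Y k \<in> borel_measurable M" "Y l \<in> borel_measurable M"
    by (auto intro: Y)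
  have f: "?f \<in> borel_measurable (borel \<Otimes>\<^sub>M borel \<Otimes>\<^sub>M borel \<Otimes>\<^sub>M borel)"
    by measurable
  have "(\<integral>\<^sup>+\<omega>. ?f (Y i \<omega>, Y j \<omega>, Y k \<omega>, Y l \<omega>) \<partial>M) =
    (\<integral>\<^sup>+x. \<integral>\<^sup>+y. \<integral>\<^sup>+u. \<integral>\<^sup>+v. ?f (x, y, u, v) \<partial>?N \<partial>?N \<partial>?N \<partial>?N)"
    by (rule nn_integral_iid4[OF indep dist law f])
  also have "\<dots> = 0"
  proof -
    have "emeasure lborel ({a..b} \<inter> {c}) = 0" for c
      using emeasure_mono[of "{a..b} \<inter> {c}" "{c}" lborel] by simp
    moreover have "indicator {0} (c - v) = (indicator {c} v :: ennreal)" for c v :: real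
      by (auto simp: indicator_def)
    ultimately show ?thesis by simp
  qed
  finally have "AE \<omega> in M. ?f (Y i \<omega>, Y j \<omega>, Y k \<omega>, Y l \<omega>) = 0"
    by (subst (asm) nn_integral_0_iff_AE) (auto simp: indicator_def cong: if_cong)
  then show ?thesis
    by eventually_elim (auto simp: indicator_def split: if_splits)
qed

section \<open>The law of the first addend of the larger sum\<close>

theorem mainTheorem5:
  fixes M :: "'w measure"
    and X :: "nat \<Rightarrow> nat \<Rightarrow> 'w \<Rightarrow> real"
    and J :: "'w \<Rightarrow> nat"
    and a b :: real
  assumes "prob_space M"
    and "a < b"
    and "prob_space.indep_vars M (\<lambda>_. borel) (\<lambda>(j, k). X j k) ({1, 2} \<times> {1, 2})"
    and "\<And>j k. j \<in> {1, 2} \<Longrightarrow> k \<in> {1, 2} \<Longrightarrow>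
           distributed M lborel (X j k) (\<lambda>x. indicator {a..b} x / measure lborel {a..b})"
    and "J \<in> measurable M (count_space {1, 2})"
    and "AE \<omega> in M. is_arg_max (\<lambda>j. X j 1 \<omega> + X j 2 \<omega>) (\<lambda>j. j \<in> {1, 2}) (J \<omega>)"
  shows "(\<forall>x. 0 \<le> first_addend_density a b x) \<and>
         distributed M lborel (\<lambda>\<omega>. X (J \<omega>) 1 \<omega>) (\<lambda>x. ennreal (first_addend_density a b x))"
proof (intro conjI allI)
  show "0 \<le> first_addend_density a b x" for x
    using first_addend_density_nonneg .
  interpret prob_space M by fact
  note [measurable] = assms(5)
  note One_nat_def[simp del] \<comment> \<open>otherwise \<open>X 1 1\<close> becomes \<open>X (Suc 0) (Suc 0)\<close>, which no measurability fact matches\<close>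
  let ?Y = "\<lambda>(j, k). X j k"
  have X: "X j k \<in> borel_measurable M" if "j \<in> {1, 2}" "k \<in> {1, 2}" for j k
    using distributed_measurable[OF assms(4)[OF that]] by simp
  have [measurable]: "X 1 1 \<in> borel_measurable M" "X 1 2 \<in> borel_measurable M"
    "X 2 1 \<in> borel_measurable M" "X 2 2 \<in> borel_measurable M"
    by (auto intro: X)
  have law: "distr M borel (?Y m) = uniform_measure lborel {a..b}"
    if m: "m \<in> {1, 2} \<times> {1, 2}" for m
  proof -
    obtain j k where jk: "m = (j, k)" "j \<in> {1, 2}" "k \<in> {1, 2}" using m by auto
    have "distr M borel (X j k) = distr M lborel (X j k)"
      by (rule distr_cong) auto
    also have "\<dots> = density lborel (\<lambda>x. indicator {a..b} x / measure lborel {a..b})"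
      using assms(4)[OF jk(2,3)] by (rule distributed_distr_eq_density)
    also have "\<dots> = uniform_measure lborel {a..b}"
      unfolding uniform_measure_def using assms(2)
      by (intro density_cong)
        (auto simp: indicator_def divide_ennreal[of 1, simplified])
    finally show ?thesis using jk by simp
  qed
  have J: "J \<omega> \<in> {1, 2}" if "\<omega> \<in> space M" for \<omega>
    using measurable_space[OF assms(5) that] by simp
  \<comment> \<open>The index \<open>J\<close> is itself random, so measurability comes from a case
    distinction on its two possible values.\<close>
  have "(\<lambda>\<omega>. if J \<omega> = 1 then X 1 1 \<omega> else X 2 1 \<omega>) \<in> borel_measurable M"
    by measurable
  also have "?this \<longleftrightarrow> (\<lambda>\<omega>. X (J \<omega>) 1 \<omega>) \<in> borel_measurable M"
    by (intro measurable_cong) (use J in force)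
  finally have XJ[measurable]: "(\<lambda>\<omega>. X (J \<omega>) 1 \<omega>) \<in> borel_measurable M" .
  have dens[measurable]: "first_addend_density a b \<in> borel_measurable borel"
    unfolding first_addend_density_def[abs_def] by measurable
  \<comment> \<open>Both orders of the index set are listed so that each pair can play the part of
    the winner.\<close>
  have grid: "{1, 2} \<times> {1, 2} = {(1, 1), (1, 2), (2, 1), (2, 2 :: nat)}"
    "{1, 2} \<times> {1, 2} = {(2, 1), (2, 2), (1, 1), (1, 2 :: nat)}"
    by auto
  have tie: "AE \<omega> in M. X 1 1 \<omega> + X 1 2 \<omega> \<noteq> X 2 1 \<omega> + X 2 2 \<omega>"
    using AE_sums_neq[OF assms(3)[unfolded grid(1)], of a b] law[unfolded grid(1)] by auto
  have "distr M lborel (\<lambda>\<omega>. X (J \<omega>) 1 \<omega>) = density lborel (\<lambda>x. ennreal (first_addend_density a b x))"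
  proof (rule measure_eqI)
    fix A assume "A \<in> sets (distr M lborel (\<lambda>\<omega>. X (J \<omega>) 1 \<omega>))"
    then have A[measurable]: "A \<in> sets borel" by simp
    have "emeasure (distr M lborel (\<lambda>\<omega>. X (J \<omega>) 1 \<omega>)) A =
      (\<integral>\<^sup>+x. indicator A x \<partial>distr M lborel (\<lambda>\<omega>. X (J \<omega>) 1 \<omega>))"
      by simp
    also have "\<dots> = (\<integral>\<^sup>+\<omega>. indicator A (X (J \<omega>) 1 \<omega>) \<partial>M)"
      by (rule nn_integral_distr) auto
    \<comment> \<open>Off the null event of a tie exactly one of the two strict inequalities holds,
      and maximality forces \<open>J\<close> to be the index of that pair.\<close>
    also have "\<dots> = (\<integral>\<^sup>+\<omega>. indicator A (X 1 1 \<omega>) * indicator {..<X 1 1 \<omega> + X 1 2 \<omega>} (X 2 1 \<omega> + X 2 2 \<omega>)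
        + indicator A (X 2 1 \<omega>) * indicator {..<X 2 1 \<omega> + X 2 2 \<omega>} (X 1 1 \<omega> + X 1 2 \<omega>) \<partial>M)"
      using assms(6) tie
      by (intro nn_integral_cong_AE, eventually_elim)
        (auto simp: is_arg_max_linorder indicator_def)
    also have "\<dots> = (\<integral>\<^sup>+\<omega>. indicator A (X 1 1 \<omega>) * indicator {..<X 1 1 \<omega> + X 1 2 \<omega>} (X 2 1 \<omega> + X 2 2 \<omega>) \<partial>M)
        + (\<integral>\<^sup>+\<omega>. indicator A (X 2 1 \<omega>) * indicator {..<X 2 1 \<omega> + X 2 2 \<omega>} (X 1 1 \<omega> + X 1 2 \<omega>) \<partial>M)"
      by (rule nn_integral_add) (simp_all add: indicator_def cong: if_cong)
    \<comment> \<open>The two integrals differ only by exchanging the pairs, so each contributes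
      half of the density.\<close>
    also have "\<dots> = (\<integral>\<^sup>+x. ennreal (first_addend_density a b x / 2) * indicator A x \<partial>lborel)
        + (\<integral>\<^sup>+x. ennreal (first_addend_density a b x / 2) * indicator A x \<partial>lborel)"
      using nn_integral_first_addend_of_larger_sum[OF assms(2) assms(3)[unfolded grid(1)] _ _ A]
        nn_integral_first_addend_of_larger_sum[OF assms(2) assms(3)[unfolded grid(2)] _ _ A]
        law[unfolded grid(1)] by auto
    also have "\<dots> = (\<integral>\<^sup>+x. ennreal (first_addend_density a b x / 2) * indicator A x
        + ennreal (first_addend_density a b x / 2) * indicator A x \<partial>lborel)"
      by (rule nn_integral_add[symmetric]) auto
    \<comment> \<open>Nonnegativity of the density allows the two halves to be added inside
      \<open>ennreal\<close>.\<close>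
    also have "\<dots> = (\<integral>\<^sup>+x. ennreal (first_addend_density a b x) * indicator A x \<partial>lborel)"
      by (intro nn_integral_cong)
        (auto simp: indicator_def first_addend_density_nonneg simp flip: ennreal_plus)
    also have "\<dots> = emeasure (density lborel (\<lambda>x. ennreal (first_addend_density a b x))) A"
      by (rule emeasure_density[symmetric]) auto
    finally show "emeasure (distr M lborel (\<lambda>\<omega>. X (J \<omega>) 1 \<omega>)) A =
      emeasure (density lborel (\<lambda>x. ennreal (first_addend_density a b x))) A" .
  qed simp
  with XJ show "distributed M lborel (\<lambda>\<omega>. X (J \<omega>) 1 \<omega>) (\<lambda>x. ennreal (first_addend_density a b x))"
    unfolding distributed_def measurable_lborel1 measurable_lborel2
    by (intro conjI) measurable
qed

end
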